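(* Let $Y$ be an almost surely positive random variable, with associated function $U$. Suppose that $k=k_n$ satisfies $k_n\to\infty$ and $k_n/n\to0$ as $n\to\infty$, and that $U\in 2ERV_{\gamma,\rho}$ with $\rho<0$ and $\gamma\in\mathbb{R}$. Let $h_n$ be a sequence. Then the sequence $z_n=\frac{h_nU(n/k)}{a(n/k)}$ satisfies $\sqrt{k}\,z_n\to0$ if one of the following conditions holds: 1. $\gamma>0$ and $\sqrt{k}\,h_n\to0$; 2. $\gamma=0$ and $\sqrt{k}\,h_n=O\left(\left(\frac nk\right)^{-\delta}\right)$ for some $\delta>0$; 3. $\gamma<0$ and $\sqrt{k}\,h_n=o\left(\left(\frac nk\right)^{\gamma}\right)$.
   Context: All limits are as $n\to\infty$ unless specified; $k=k_n<n$ is a positive integer. For a random variable $Y$ with distribution function $F$, $U(t)=F^{\leftarrow}(1-1/t)$ for $t>1$, where $g^{\leftarrow}(x)=\inf\{y\in\mathbb{R}: g(y)\ge x\}$. $U\in 2ERV_{\gamma,\rho}$ (second-order extended regular variation with $\gamma\in\mathbb{R}$, $\rho\le0$) means that there are a positive scaling function $a$ and a function $A$ of constant sign with $\lim_{t\to\infty}A(t)=0$ such that $$\lim_{t\to\infty}\frac{\frac{U(tx)-U(t)}{a(t)}-\frac{x^\gamma-1}{\gamma}}{A(t)}=\frac1\rho\left(\frac{x^{\gamma+\rho}-1}{\gamma+\rho}-\frac{x^\gamma-1}{\gamma}\right)=:H_{\gamma,\rho}(x)\quad\text{for all }x>0,$$ where expressions with a vanishing denominator are interpreted as limits (e.g.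 $\frac{x^\gamma-1}{\gamma}=\ln x$ for $\gamma=0$). The function $a$ in the claim is the scaling function from this condition. *)

theory Defs
  imports "HOL-Probability.Probability" "HOL-Library.Landau_Symbols" "HOL-Real_Asymp.Real_Asymp"
begin

text \<open>
  The real infimum is the intended one only if the set below is nonempty and bounded below.  For a
  distribution function \<open>g\<close> this is the case at all levels \<open>0 < x < 1\<close>.
\<close>

definition left_inverse :: "(real \<Rightarrow> real) \<Rightarrow> real \<Rightarrow> real" where
  "left_inverse g x = Inf {y. g y \<ge> x}"

text \<open>Meaningful for \<open>t > 1\<close> only.\<close>

definition tail_quantile :: "'a measure \<Rightarrow> ('a \<Rightarrow> real) \<Rightarrow> real \<Rightarrow> real" where
  "tail_quantile M Y t = left_inverse (cdf (distr M borel Y)) (1 - 1 / t)"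

definition pow_quot :: "real \<Rightarrow> real \<Rightarrow> real" where
  "pow_quot \<gamma> x = (if \<gamma> = 0 then ln x else (x powr \<gamma> - 1) / \<gamma>)"

definition erv2_lim :: "real \<Rightarrow> real \<Rightarrow> real \<Rightarrow> real" where
  "erv2_lim \<gamma> \<rho> x =
     (if \<rho> \<noteq> 0 then 1 / \<rho> * (pow_quot (\<gamma> + \<rho>) x - pow_quot \<gamma> x)
      else if \<gamma> \<noteq> 0 then 1 / \<gamma> * (x powr \<gamma> * ln x - (x powr \<gamma> - 1) / \<gamma>)
      else (ln x)\<^sup>2 / 2)"

text \<open>The values at vanishing denominators are the corresponding limits.\<close>

lemma pow_quot_tendsto:
  assumes "x > 0"
  shows "((\<lambda>g. (x powr g - 1) / g) \<longlongrightarrow> pow_quot 0 x) (at 0)"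
proof -
  have "((\<lambda>g. x powr g) has_real_derivative ln x) (at 0)"
    using assms by (auto intro!: derivative_eq_intros)
  then show ?thesis
    using assms by (simp add: has_field_derivative_iff pow_quot_def)
qed

lemma erv2_lim_tendsto:
  assumes "x > 0"
  shows "((\<lambda>r. erv2_lim \<gamma> r x) \<longlongrightarrow> erv2_lim \<gamma> 0 x) (at 0)"
proof (cases "\<gamma> = 0")
  case True
  have "((\<lambda>r. 1 / r * ((exp (r * l) - 1) / r - l)) \<longlongrightarrow> l\<^sup>2 / 2) (at 0)" for l :: real
  proof (cases l "0 :: real" rule: linorder_cases)
    case less
    then show ?thesis unfolding power2_eq_square by real_asymp
  next
    case equal
    then show ?thesis by simp
  next
    case greater
    then show ?thesis unfolding power2_eq_square by real_asymp
  qed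
  then have "((\<lambda>r. 1 / r * ((exp (r * ln x) - 1) / r - ln x)) \<longlongrightarrow> erv2_lim \<gamma> 0 x) (at 0)"
    using True by (simp add: erv2_lim_def)
  then show ?thesis
    by (rule Lim_transform_eventually)
       (use True assms in \<open>auto simp: eventually_at_filter erv2_lim_def pow_quot_def powr_def\<close>)
next
  case False
  have "((\<lambda>g. (x powr g - 1) / g) has_real_derivative erv2_lim \<gamma> 0 x) (at \<gamma>)"
    using assms False
    by (auto intro!: derivative_eq_intros simp: erv2_lim_def field_simps power2_eq_square)
  then have lim: "((\<lambda>r. ((x powr (\<gamma> + r) - 1) / (\<gamma> + r) - (x powr \<gamma> - 1) / \<gamma>) / r)
      \<longlongrightarrow> erv2_lim \<gamma> 0 x) (at 0)"
    by (simp add: DERIV_def)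
  have "eventually (\<lambda>r. r \<noteq> - \<gamma>) (at 0)"
    using False by (intro eventually_neq_at_within)
  then have "eventually (\<lambda>r. ((x powr (\<gamma> + r) - 1) / (\<gamma> + r) - (x powr \<gamma> - 1) / \<gamma>) / r
      = erv2_lim \<gamma> r x) (at 0)"
    using eventually_neq_at_within[of 0 0 UNIV]
    by eventually_elim (use False in \<open>auto simp: erv2_lim_def pow_quot_def\<close>)
  with lim show ?thesis
    by (rule Lim_transform_eventually)
qed

text \<open>
  Second-order extended regular variation of \<open>U\<close> with scaling function \<open>a\<close> and auxiliary function
  \<open>A\<close>.  All functions are considered on \<open>(1, \<infinity>)\<close>.  Constant sign is strict, as \<open>A\<close> is divided by.
\<close>

definition erv2 ::
    "(real \<Rightarrow> real) \<Rightarrow> real \<Rightarrow> real \<Rightarrow> (real \<Rightarrow> real) \<Rightarrow> (real \<Rightarrow> real) \<Rightarrow> bool" where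
  "erv2 U \<gamma> \<rho> a A \<longleftrightarrow>
     \<rho> \<le> 0 \<and>
     (\<forall>t>1. a t > 0) \<and>
     ((\<forall>t>1. A t > 0) \<or> (\<forall>t>1. A t < 0)) \<and>
     (A \<longlongrightarrow> 0) at_top \<and>
     (\<forall>x>0. ((\<lambda>t. ((U (t * x) - U t) / a t - pow_quot \<gamma> x) / A t)
               \<longlongrightarrow> erv2_lim \<gamma> \<rho> x) at_top)"

end

theory Submission
  imports Defs
begin

text \<open>
  Everything reduces to a growth bound for the deterministic function \<open>U / a\<close>.  Put \<open>t\<^sub>n = n / k\<^sub>n\<close>, which
  tends to infinity.  If \<open>U t / a t = O(t powr \<epsilon>)\<close> and \<open>sqrt k h = o(t\<^sub>n powr - \<epsilon>)\<close>, then
  \<open>sqrt k z\<close>, the product of \<open>sqrt k h\<close> and \<open>U t\<^sub>n / a t\<^sub>n\<close>, tends to \<open>0\<close>.  The three conditions match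
  \<open>\<epsilon> = 0\<close> for \<open>\<gamma> > 0\<close>, \<open>\<epsilon> = \<delta> / 2\<close> for \<open>\<gamma> = 0\<close>, and \<open>\<epsilon> = - \<gamma>\<close> for \<open>\<gamma> < 0\<close>.

  To prove the bound, replace \<open>a\<close> by the dyadic increment \<open>v t = U (2 t) - U t\<close>: by the first-order
  part of the hypothesis, \<open>v / a\<close> has a positive limit.  With \<open>\<theta> t = v (2 t) / v t\<close>, the quotient
  \<open>R = U / v\<close> satisfies the exact recursion \<open>R (2 t) = (R t + 1) / \<theta> t\<close>, and \<open>\<theta> t\<close> tends to
  \<open>2 powr \<gamma>\<close>.  Along \<open>s, 2 s, 4 s, \<dots>\<close> the quotient \<open>R\<close> is thus eventually multiplied at each step by a
  factor close to \<open>2 powr - \<gamma>\<close>, so that \<open>R t = O(t powr \<epsilon>)\<close> for every \<open>\<epsilon> \<ge> 0\<close> with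
  \<open>\<epsilon> > - \<gamma>\<close> (lemma \<open>dyadic_quotient_bigo_above_index\<close>).  The bound is uniform in the starting point
  \<open>s \<in> [T, 2 T]\<close> because \<open>U\<close>, a quantile function of a positive variable, is nonnegative and
  nondecreasing.

  For \<open>\<gamma> < 0\<close> the sharp exponent \<open>- \<gamma>\<close> is required, so the product of the factors
  \<open>2 powr \<gamma> / \<theta> (2 ^ j s)\<close> must stay bounded.  This is where \<open>\<rho> < 0\<close> is used: the deviation
  \<open>\<theta> t - 2 powr \<gamma>\<close> is asymptotically a nonzero multiple of \<open>A t\<close>, and the second-order condition at
  \<open>2, 4, 8\<close> shows that it is multiplied by about \<open>2 powr \<rho> < 1\<close> when \<open>t\<close> is doubled
  (lemma \<open>erv2_dyadic_deviation_ratio\<close>).  The deviations are therefore summable along the orbit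
  (lemma \<open>dyadic_quotient_bigo_at_index\<close>).
\<close>

section \<open>Tail quantiles of a positive random variable\<close>

lemma tail_quantile_nonneg_mono:
  assumes "prob_space M" and "Y \<in> borel_measurable M" and "AE \<omega> in M. Y \<omega> > 0"
  shows "1 < t \<Longrightarrow> 0 \<le> tail_quantile M Y t"
    and "1 < s \<Longrightarrow> s \<le> t \<Longrightarrow> tail_quantile M Y s \<le> tail_quantile M Y t"
proof -
  interpret P: prob_space M by fact
  interpret N: real_distribution "distr M borel Y"
    using assms(2) by (simp add: P.real_distribution_distr)
  let ?F = "cdf (distr M borel Y)"
  have F0: "?F y = 0" if "y \<le> 0" for y
  proof -
    have "?F y = measure M {\<omega> \<in> space M. Y \<omega> \<le> y}"
      using assms(2) by (simp add: cdf_def measure_distr vimage_def Int_def conj_commute)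
    also have "\<dots> = 0"
      using assms(3) that by (intro P.prob_eq_0_AE) (auto elim: eventually_mono)
    finally show ?thesis .
  qed
  have level: "{y. ?F y \<ge> 1 - 1 / t} \<noteq> {} \<and> (\<forall>y \<in> {y. ?F y \<ge> 1 - 1 / t}. 0 \<le> y)"
    if "1 < t" for t
  proof -
    have p: "0 < 1 - 1 / t" "1 - 1 / t < 1"
      using that by (auto simp: field_simps)
    have "eventually (\<lambda>y. 1 - 1 / t < ?F y) at_top"
      using N.cdf_lim_at_top_prob p(2) by (rule order_tendstoD)
    then obtain y where "1 - 1 / t < ?F y"
      using eventually_happens by fastforce
    moreover have "0 \<le> y" if "1 - 1 / t \<le> ?F y" for y
      using F0[of y] p(1) that by linarith
    ultimately show ?thesis
      by (auto intro: less_imp_le)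
  qed
  show "0 \<le> tail_quantile M Y t" if "1 < t" for t
    unfolding tail_quantile_def left_inverse_def
    using level[OF that] by (intro cInf_greatest) auto
  show "tail_quantile M Y s \<le> tail_quantile M Y t" if "1 < s" "s \<le> t" for s t
    unfolding tail_quantile_def left_inverse_def
  proof (rule cInf_superset_mono)
    show "{y. 1 - 1 / t \<le> ?F y} \<noteq> {}"
      using level[of t] that by simp
    show "bdd_below {y. 1 - 1 / s \<le> ?F y}"
      using level[of s] that by (auto simp: bdd_below_def)
    have "1 / t \<le> 1 / s"
      using that by (simp add: frac_le)
    then show "{y. 1 - 1 / t \<le> ?F y} \<subseteq> {y. 1 - 1 / s \<le> ?F y}"
      by auto
  qed
qed

section \<open>Dyadic increments under second-order extended regular variation\<close>

lemma pow_quot_mult: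
  assumes "x > 0" "y > 0"
  shows "pow_quot g (x * y) = pow_quot g x + x powr g * pow_quot g y"
  using assms by (auto simp: pow_quot_def ln_mult powr_mult field_simps)

lemma pow_quot_2_pos: "pow_quot g 2 > 0"
proof (cases g "0 :: real" rule: linorder_cases)
  case less
  then have "2 powr g < (1 :: real)" by (simp add: powr_less_one)
  then show ?thesis using less by (simp add: pow_quot_def divide_neg_neg)
next
  case greater
  then have "2 powr g > (1 :: real)" by (simp add: gr_one_powr)
  then show ?thesis using greater by (simp add: pow_quot_def)
qed (simp add: pow_quot_def)

lemma pow_quot_4: "pow_quot g 4 = (1 + 2 powr g) * pow_quot g 2"
  using pow_quot_mult[of 2 2 g] by (simp add: algebra_simps)

lemma pow_quot_8: "pow_quot g 8 = (1 + 2 powr g + (2 powr g)\<^sup>2) * pow_quot g 2"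
  using pow_quot_mult[of 2 4 g] by (simp add: pow_quot_4 algebra_simps power2_eq_square)

definition dyadic_incr :: "(real \<Rightarrow> real) \<Rightarrow> real \<Rightarrow> real" where
  "dyadic_incr U t = U (2 * t) - U t"

definition dyadic_ratio :: "(real \<Rightarrow> real) \<Rightarrow> real \<Rightarrow> real" where
  "dyadic_ratio U t = dyadic_incr U (2 * t) / dyadic_incr U t"

text \<open>
  Since \<open>A\<close> tends to \<open>0\<close>, multiplying the second-order limit by \<open>A\<close> leaves the first-order one.
\<close>

lemma erv2_increment_tendsto:
  assumes "erv2 U \<gamma> \<rho> a A" "x > 0"
  shows "((\<lambda>t. (U (t * x) - U t) / a t) \<longlongrightarrow> pow_quot \<gamma> x) at_top"
proof -
  let ?E = "\<lambda>t. ((U (t * x) - U t) / a t - pow_quot \<gamma> x) / A t"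
  have "((\<lambda>t. ?E t * A t + pow_quot \<gamma> x) \<longlongrightarrow> erv2_lim \<gamma> \<rho> x * 0 + pow_quot \<gamma> x) at_top"
    using assms by (intro tendsto_intros) (auto simp: erv2_def)
  moreover have "eventually (\<lambda>t. ?E t * A t + pow_quot \<gamma> x = (U (t * x) - U t) / a t) at_top"
    using eventually_gt_at_top[of 1]
  proof eventually_elim
    case (elim t)
    then have "A t \<noteq> 0" using assms(1) by (auto simp: erv2_def)
    then show ?case by simp
  qed
  ultimately show ?thesis
    by (simp add: tendsto_cong)
qed

lemma erv2_dyadic_incr_over_scale:
  assumes "erv2 U \<gamma> \<rho> a A"
  shows "((\<lambda>t. dyadic_incr U t / a t) \<longlongrightarrow> pow_quot \<gamma> 2) at_top"
  using erv2_increment_tendsto[OF assms, of 2] by (simp add: dyadic_incr_def mult.commute)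

lemma erv2_dyadic_incr_pos:
  assumes "erv2 U \<gamma> \<rho> a A"
  shows "eventually (\<lambda>t. 0 < dyadic_incr U t) at_top"
  using order_tendstoD(1)[OF erv2_dyadic_incr_over_scale[OF assms] pow_quot_2_pos]
    eventually_gt_at_top[of 1]
proof eventually_elim
  case (elim t)
  then have "a t > 0" using assms by (simp add: erv2_def)
  then show ?case using elim(1) by (simp add: zero_less_divide_iff)
qed

lemma erv2_dyadic_ratio_tendsto:
  assumes "erv2 U \<gamma> \<rho> a A"
  shows "(dyadic_ratio U \<longlongrightarrow> 2 powr \<gamma>) at_top"
proof -
  let ?D = "\<lambda>x t. (U (t * x) - U t) / a t"
  have "((\<lambda>t. (?D 4 t - ?D 2 t) / ?D 2 t) \<longlongrightarrow> (pow_quot \<gamma> 4 - pow_quot \<gamma> 2) / pow_quot \<gamma> 2) at_top"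
    using pow_quot_2_pos[of \<gamma>]
    by (intro tendsto_intros erv2_increment_tendsto[OF assms]) auto
  moreover have "eventually (\<lambda>t. (?D 4 t - ?D 2 t) / ?D 2 t = dyadic_ratio U t) at_top"
    using eventually_gt_at_top[of 1]
  proof eventually_elim
    case (elim t)
    then have "a t > 0" using assms by (simp add: erv2_def)
    then show ?case
      by (simp add: dyadic_ratio_def dyadic_incr_def mult.commute diff_divide_distrib[symmetric])
  qed
  moreover have "(pow_quot \<gamma> 4 - pow_quot \<gamma> 2) / pow_quot \<gamma> 2 = 2 powr \<gamma>"
    using pow_quot_2_pos[of \<gamma>] by (simp add: pow_quot_4 field_simps)
  ultimately show ?thesis
    by (simp add: tendsto_cong)
qed

text \<open>
  Write \<open>E x t\<close> for the second-order quotient at \<open>x\<close>.  The factorisations of \<open>pow_quot \<gamma> 4\<close> and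
  \<open>pow_quot \<gamma> 8\<close> through \<open>pow_quot \<gamma> 2\<close> make the first-order terms cancel in both \<open>\<eta> t\<close> and
  \<open>\<eta> (2 t)\<close>, which therefore are of the order of \<open>A t\<close>.  As \<open>\<eta> (2 t)\<close> is expressed through increments
  from \<open>t\<close>, both refer to the same \<open>A t\<close>, and this cancels in their quotient.  The limits of \<open>\<eta> t / A t\<close> and
  \<open>\<eta> (2 t) / A t\<close> only involve the \<open>pow_quot (\<gamma> + \<rho>)\<close> part of the limit function, and it is there that
  \<open>\<rho> \<noteq> 0\<close> makes the first of them nonzero.
\<close>

lemma erv2_dyadic_deviation_ratio:
  assumes erv: "erv2 U \<gamma> \<rho> a A" and "\<rho> < 0"
  defines "\<eta> \<equiv> \<lambda>t. dyadic_ratio U t - 2 powr \<gamma>"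
  shows "((\<lambda>t. \<eta> (2 * t) / \<eta> t) \<longlongrightarrow> 2 powr \<rho>) at_top"
    and "eventually (\<lambda>t. \<eta> t \<noteq> 0) at_top"
proof -
  define D where "D x t = (U (t * x) - U t) / a t" for x t
  define E where "E x t = (D x t - pow_quot \<gamma> x) / A t" for x t
  define H where "H = erv2_lim \<gamma> \<rho>"
  define g where "g = 2 powr \<gamma>"
  define r where "r = 2 powr \<rho>"
  define p where "p = pow_quot \<gamma> 2"
  define d where "d = pow_quot (\<gamma> + \<rho>) 2 * g * (r - 1) / (\<rho> * p)"
  have D: "(D x \<longlongrightarrow> pow_quot \<gamma> x) at_top" if "x > 0" for x
    using erv2_increment_tendsto[OF erv that] by (simp add: D_def[abs_def])
  have E: "(E x \<longlongrightarrow> H x) at_top" if "x > 0" for x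
    using erv that by (simp add: erv2_def E_def[abs_def] D_def H_def)
  have pos: "p > 0" "g > 0" "r > 0" "r < 1"
    using pow_quot_2_pos \<open>\<rho> < 0\<close> by (auto simp: p_def g_def r_def powr_less_one)
  then have d0: "d \<noteq> 0"
    using pow_quot_2_pos[of "\<gamma> + \<rho>"] \<open>\<rho> < 0\<close> by (auto simp: d_def)
  have gr: "2 powr (\<gamma> + \<rho>) = g * r"
    by (simp add: g_def r_def powr_add)
  have "((\<lambda>t. (E 4 t - (1 + g) * E 2 t) / D 2 t)
      \<longlongrightarrow> (H 4 - (1 + g) * H 2) / pow_quot \<gamma> 2) at_top"
    using pos by (intro tendsto_intros D E) (auto simp: p_def)
  also have "(H 4 - (1 + g) * H 2) / pow_quot \<gamma> 2 = d"
    using pos \<open>\<rho> < 0\<close>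
    by (simp add: H_def erv2_lim_def pow_quot_4 gr d_def flip: g_def p_def) (simp add: field_simps)
  finally have l1: "((\<lambda>t. (E 4 t - (1 + g) * E 2 t) / D 2 t) \<longlongrightarrow> d) at_top" .
  have "((\<lambda>t. (E 8 t - E 4 t - g * (E 4 t - E 2 t)) / (D 4 t - D 2 t))
      \<longlongrightarrow> (H 8 - H 4 - g * (H 4 - H 2)) / (pow_quot \<gamma> 4 - pow_quot \<gamma> 2)) at_top"
    using pos by (intro tendsto_intros D E) (auto simp: pow_quot_4 p_def g_def)
  also have "(H 8 - H 4 - g * (H 4 - H 2)) / (pow_quot \<gamma> 4 - pow_quot \<gamma> 2) = r * d"
    using pos \<open>\<rho> < 0\<close>
    by (simp add: H_def erv2_lim_def pow_quot_4 pow_quot_8 gr d_def flip: g_def p_def)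
       (simp add: field_simps power2_eq_square)
  finally have l2: "((\<lambda>t. (E 8 t - E 4 t - g * (E 4 t - E 2 t)) / (D 4 t - D 2 t))
      \<longlongrightarrow> r * d) at_top" .
  have ev: "eventually (\<lambda>t. A t \<noteq> 0 \<and> a t > 0 \<and> 0 < dyadic_incr U t \<and> 0 < dyadic_incr U (2 * t)) at_top"
  proof -
    have "filterlim (\<lambda>t :: real. 2 * t) at_top at_top" by real_asymp
    then have "eventually (\<lambda>t. 0 < dyadic_incr U (2 * t)) at_top"
      using erv2_dyadic_incr_pos[OF erv] by (rule eventually_compose_filterlim[rotated])
    with erv2_dyadic_incr_pos[OF erv] eventually_gt_at_top[of 1] show ?thesis
      by eventually_elim (use erv in \<open>auto simp: erv2_def\<close>)
  qed
  then have e1: "eventually (\<lambda>t. (E 4 t - (1 + g) * E 2 t) / D 2 t = \<eta> t / A t) at_top"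
  proof eventually_elim
    case (elim t)
    have "E 4 t - (1 + g) * E 2 t = (D 4 t - (1 + g) * D 2 t) / A t"
      using elim by (simp add: E_def pow_quot_4 flip: g_def) (simp add: field_simps)
    moreover have "D 4 t = (dyadic_incr U (2 * t) + dyadic_incr U t) / a t"
      "D 2 t = dyadic_incr U t / a t"
      by (simp_all add: D_def dyadic_incr_def mult.commute)
    ultimately show ?case
      using elim by (simp add: \<eta>_def dyadic_ratio_def flip: g_def) (simp add: field_simps)
  qed
  from ev have e2: "eventually (\<lambda>t. (E 8 t - E 4 t - g * (E 4 t - E 2 t)) / (D 4 t - D 2 t)
      = \<eta> (2 * t) / A t) at_top"
  proof eventually_elim
    case (elim t)
    have "E 8 t - E 4 t - g * (E 4 t - E 2 t) = (D 8 t - D 4 t - g * (D 4 t - D 2 t)) / A t"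
      using elim by (simp add: E_def pow_quot_4 pow_quot_8 flip: g_def)
        (simp add: field_simps power2_eq_square)
    moreover have "D 8 t - D 4 t = dyadic_incr U (2 * (2 * t)) / a t"
      "D 4 t - D 2 t = dyadic_incr U (2 * t) / a t"
      by (simp_all add: D_def dyadic_incr_def mult.commute diff_divide_distrib[symmetric])
    ultimately show ?case
      using elim by (simp add: \<eta>_def dyadic_ratio_def flip: g_def) (simp add: field_simps)
  qed
  have l1': "((\<lambda>t. \<eta> t / A t) \<longlongrightarrow> d) at_top"
    using l1 tendsto_cong[OF e1] by simp
  have l2': "((\<lambda>t. \<eta> (2 * t) / A t) \<longlongrightarrow> r * d) at_top"
    using l2 tendsto_cong[OF e2] by simp
  show nz: "eventually (\<lambda>t. \<eta> t \<noteq> 0) at_top"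
    using tendsto_imp_eventually_ne[OF l1' d0] by eventually_elim auto
  have "((\<lambda>t. (\<eta> (2 * t) / A t) / (\<eta> t / A t)) \<longlongrightarrow> r * d / d) at_top"
    using l1' l2' d0 by (intro tendsto_divide)
  moreover have "eventually (\<lambda>t. (\<eta> (2 * t) / A t) / (\<eta> t / A t) = \<eta> (2 * t) / \<eta> t) at_top"
    using ev by eventually_elim auto
  ultimately have "((\<lambda>t. \<eta> (2 * t) / \<eta> t) \<longlongrightarrow> r * d / d) at_top"
    by (rule Lim_transform_eventually)
  then show "((\<lambda>t. \<eta> (2 * t) / \<eta> t) \<longlongrightarrow> 2 powr \<rho>) at_top"
    using d0 by (simp add: r_def)
qed

section \<open>Growth of a monotone function relative to its dyadic increments\<close>

text \<open>
  Every point of \<open>[T, \<infinity>)\<close> is reached from \<open>[T, 2 T]\<close> by repeated doubling.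
\<close>

lemma doubling_induct [consumes 1, case_names pos base double]:
  fixes T t :: real
  assumes "T \<le> t" and "T > 0"
    and base: "\<And>s. T \<le> s \<Longrightarrow> s \<le> 2 * T \<Longrightarrow> P s"
    and step: "\<And>s. T \<le> s \<Longrightarrow> P s \<Longrightarrow> P (2 * s)"
  shows "P t"
proof -
  have "P t" if "T \<le> t" "t \<le> 2 ^ n * T" for n t
    using that
  proof (induction n arbitrary: t)
    case 0
    then show ?case using base \<open>T > 0\<close> by simp
  next
    case (Suc n)
    show ?case
    proof (cases "t \<le> 2 * T")
      case False
      then have "P (t / 2)" using Suc by (intro Suc.IH) auto
      then have "P (2 * (t / 2))" using False by (intro step) auto
      then show ?thesis by simp
    qed (use base Suc in auto)
  qed
  moreover obtain n where "t / T < 2 ^ n"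
    using real_arch_pow[of 2 "t / T"] by auto
  then have "t \<le> 2 ^ n * T"
    using \<open>T > 0\<close> by (simp add: pos_divide_less_eq less_imp_le)
  ultimately show ?thesis
    using \<open>T \<le> t\<close> by blast
qed

text \<open>
  Starts the doubling argument.  The point is a positive lower bound for the increment at \<open>s\<close> that does
  not depend on \<open>s\<close>: the interval \<open>[s, 4 s]\<close> contains \<open>[2 T, 4 T]\<close>, so monotonicity bounds the sum of the
  increments at \<open>s\<close> and \<open>2 s\<close> from below, and the second of these is at most \<open>C\<close> times the first.
\<close>

lemma dyadic_quotient_bounded_base:
  assumes nonneg: "\<And>t. 1 < t \<Longrightarrow> 0 \<le> U t"
    and mono: "\<And>s t. 1 < s \<Longrightarrow> s \<le> t \<Longrightarrow> U s \<le> U t"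
    and "1 < T" and pos: "\<And>t. T \<le> t \<Longrightarrow> 0 < dyadic_incr U t"
    and ratio: "\<And>t. T \<le> t \<Longrightarrow> dyadic_ratio U t \<le> C"
    and s: "T \<le> s" "s \<le> 2 * T"
  shows "U s / dyadic_incr U s \<le> U (2 * T) * (1 + C) / dyadic_incr U (2 * T)"
proof -
  have "dyadic_incr U (2 * T) \<le> U (4 * s) - U s"
    using mono[of s "2 * T"] mono[of "4 * T" "4 * s"] s \<open>1 < T\<close> by (simp add: dyadic_incr_def)
  also have "\<dots> = dyadic_incr U s + dyadic_incr U (2 * s)"
    by (simp add: dyadic_incr_def)
  also have "\<dots> \<le> (1 + C) * dyadic_incr U s"
    using pos[of s] ratio[of s] s by (simp add: dyadic_ratio_def field_simps)
  finally have low: "dyadic_incr U (2 * T) \<le> (1 + C) * dyadic_incr U s" .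
  have "U s * dyadic_incr U (2 * T) \<le> U (2 * T) * ((1 + C) * dyadic_incr U s)"
    using low mono[of s "2 * T"] nonneg[of s] s \<open>1 < T\<close> pos[of "2 * T"]
    by (intro mult_mono) auto
  then show ?thesis
    using pos[of s] pos[of "2 * T"] s \<open>1 < T\<close> by (simp add: field_simps)
qed

lemma dyadic_quotient_double:
  assumes "0 < dyadic_incr U t" "0 < dyadic_incr U (2 * t)"
  shows "U (2 * t) / dyadic_incr U (2 * t) = (U t / dyadic_incr U t + 1) / dyadic_ratio U t"
  using assms by (simp add: dyadic_ratio_def field_simps) (simp add: dyadic_incr_def algebra_simps)

text \<open>
  After division by \<open>t powr \<epsilon>\<close>, the doubling recursion is dominated by \<open>S \<mapsto> \<kappa> (S + 1)\<close>
  with \<open>\<kappa> < 1\<close>, which maps \<open>[0, B]\<close> into itself as soon as \<open>B \<ge> \<kappa> / (1 - \<kappa>)\<close>.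
\<close>

lemma dyadic_quotient_bigo_above_index:
  assumes nonneg: "\<And>t. 1 < t \<Longrightarrow> 0 \<le> U t"
    and mono: "\<And>s t. 1 < s \<Longrightarrow> s \<le> t \<Longrightarrow> U s \<le> U t"
    and pos: "eventually (\<lambda>t. 0 < dyadic_incr U t) at_top"
    and ratio: "(dyadic_ratio U \<longlongrightarrow> 2 powr \<gamma>) at_top"
    and \<epsilon>: "0 \<le> \<epsilon>" "- \<gamma> < \<epsilon>"
  shows "(\<lambda>t. U t / dyadic_incr U t) \<in> O(\<lambda>t. t powr \<epsilon>)"
proof -
  \<comment> \<open>The exponent of \<open>m\<close> is the midpoint of \<open>- \<epsilon>\<close> and \<open>\<gamma>\<close>: below the limit of the ratio, yet with
    \<open>m * 2 powr \<epsilon> > 1\<close>.\<close>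
  define m where "m = 2 powr ((\<gamma> - \<epsilon>) / 2)"
  define \<kappa> where "\<kappa> = 1 / (m * 2 powr \<epsilon>)"
  define C where "C = 2 powr \<gamma> + (1 :: real)"
  have m: "0 < m" "m < 2 powr \<gamma>"
    using \<epsilon> by (auto simp: m_def)
  have "m * 2 powr \<epsilon> = 2 powr ((\<gamma> + \<epsilon>) / 2)"
    by (simp add: m_def field_simps flip: powr_add)
  moreover have "2 powr ((\<gamma> + \<epsilon>) / 2) > (1 :: real)"
    using \<epsilon> by (intro gr_one_powr) auto
  ultimately have \<kappa>: "0 < \<kappa>" "\<kappa> < 1"
    using m by (auto simp: \<kappa>_def)
  have "eventually (\<lambda>t. 1 < t \<and> 0 < dyadic_incr U t \<and> m < dyadic_ratio U t \<and> dyadic_ratio U t < C) at_top"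
    using pos order_tendstoD(1)[OF ratio m(2)] order_tendstoD(2)[OF ratio, of C]
      eventually_gt_at_top[of 1]
    by (simp add: C_def eventually_conj_iff)
  then obtain T where T: "\<And>t. T \<le> t \<Longrightarrow> 1 < t \<and> 0 < dyadic_incr U t \<and> m < dyadic_ratio U t \<and> dyadic_ratio U t < C"
    by (auto simp: eventually_at_top_linorder)
  define B where "B = max (U (2 * T) * (1 + C) / dyadic_incr U (2 * T)) (\<kappa> / (1 - \<kappa>))"
  have T1: "1 < T" using T[of T] by simp
  have B: "\<kappa> * (B + 1) \<le> B"
  proof -
    have "\<kappa> / (1 - \<kappa>) \<le> B" by (simp add: B_def)
    then show ?thesis using \<kappa> by (simp add: field_simps)
  qed
  have "0 \<le> B" using \<kappa> by (auto simp: B_def le_max_iff_disj)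
  have bound: "U t / dyadic_incr U t \<le> B * t powr \<epsilon>" if "T \<le> t" for t
    using that
  proof (induction rule: doubling_induct)
    case pos
    then show ?case using T1 by simp
  next
    case (base s)
    have "U s / dyadic_incr U s \<le> U (2 * T) * (1 + C) / dyadic_incr U (2 * T)"
      using T T1 base less_imp_le by (intro dyadic_quotient_bounded_base nonneg mono) blast+
    also have "\<dots> \<le> B" by (simp add: B_def)
    also have "\<dots> \<le> B * s powr \<epsilon>"
      using \<open>0 \<le> B\<close> T[OF base(1)] \<epsilon> by (simp add: mult_le_cancel_left1 ge_one_powr_ge_zero)
    finally show ?case .
  next
    case (double s)
    have s: "1 < s" "0 < dyadic_incr U s" "0 < dyadic_incr U (2 * s)" "m < dyadic_ratio U s"
      using T[of s] T[of "2 * s"] double(1) T1 by auto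
    have "1 \<le> s powr \<epsilon>" using s \<epsilon> by (simp add: ge_one_powr_ge_zero)
    have "U (2 * s) / dyadic_incr U (2 * s) = (U s / dyadic_incr U s + 1) / dyadic_ratio U s"
      using s by (intro dyadic_quotient_double) auto
    also have "\<dots> \<le> (B * s powr \<epsilon> + s powr \<epsilon>) / m"
      using double(2) s m \<open>0 \<le> B\<close> \<open>1 \<le> s powr \<epsilon>\<close>
      by (intro frac_le add_nonneg_nonneg add_mono) auto
    also have "\<dots> = \<kappa> * (B + 1) * (2 * s) powr \<epsilon>"
      using m s by (simp add: \<kappa>_def powr_mult field_simps)
    also have "\<dots> \<le> B * (2 * s) powr \<epsilon>"
      using B by (intro mult_right_mono) auto
    finally show ?case .
  qed
  show ?thesis
  proof (rule bigoI)
    show "eventually (\<lambda>t. norm (U t / dyadic_incr U t) \<le> B * norm (t powr \<epsilon>)) at_top"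
      using eventually_ge_at_top[of T]
    proof eventually_elim
      case (elim t)
      then show ?case using bound[of t] T[of t] nonneg[of t] by simp
    qed
  qed
qed

text \<open>
  At the exponent \<open>- \<gamma>\<close> the contraction factor is lost: \<open>S t = R t * t powr \<gamma>\<close> only satisfies
  \<open>S (2 t) + 1 \<le> exp (2 * G t) * (S t + 1)\<close>, where the error \<open>G\<close> collects the deviation of the
  dyadic ratio and the inhomogeneous term \<open>t powr \<gamma>\<close>.  Both decay geometrically under doubling,
  \<open>G (2 t) \<le> \<mu> * G t\<close>, and the sum of the errors still to come is at most \<open>G t / (1 - \<mu>)\<close>.  Hence
  \<open>W t = (S t + 1) * exp (2 * G t / (1 - \<mu>))\<close>, which anticipates them all, does not increase under doubling.
\<close>

lemma dyadic_quotient_bigo_at_index: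
  assumes nonneg: "\<And>t. 1 < t \<Longrightarrow> 0 \<le> U t"
    and mono: "\<And>s t. 1 < s \<Longrightarrow> s \<le> t \<Longrightarrow> U s \<le> U t"
    and pos: "eventually (\<lambda>t. 0 < dyadic_incr U t) at_top"
    and ratio: "(dyadic_ratio U \<longlongrightarrow> 2 powr \<gamma>) at_top"
    and "\<gamma> < 0" and \<beta>: "\<beta> < 1"
    and decay: "eventually (\<lambda>t. \<bar>dyadic_ratio U (2 * t) - 2 powr \<gamma>\<bar>
                  \<le> \<beta> * \<bar>dyadic_ratio U t - 2 powr \<gamma>\<bar>) at_top"
  shows "(\<lambda>t. U t / dyadic_incr U t) \<in> O(\<lambda>t. t powr - \<gamma>)"
proof -
  define g where "g = 2 powr \<gamma>"
  define \<mu> where "\<mu> = max \<beta> g"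
  define G where "G t = 2 / g * \<bar>dyadic_ratio U t - g\<bar> + t powr \<gamma>" for t
  define R where "R t = U t / dyadic_incr U t" for t
  define W where "W t = (R t * t powr \<gamma> + 1) * exp (2 * G t / (1 - \<mu>))" for t
  have g: "0 < g" "g < 1"
    using \<open>\<gamma> < 0\<close> by (auto simp: g_def powr_less_one)
  then have \<mu>: "\<mu> < 1" "\<beta> \<le> \<mu>" "g \<le> \<mu>" using \<beta> by (auto simp: \<mu>_def)
  have ratio': "(dyadic_ratio U \<longlongrightarrow> g) at_top" using ratio by (simp add: g_def)
  have "eventually (\<lambda>t. 1 < t \<and> 0 < dyadic_incr U t \<and> g / 2 < dyadic_ratio U t \<and>
      dyadic_ratio U t < 2 * g \<and> \<bar>dyadic_ratio U (2 * t) - g\<bar> \<le> \<beta> * \<bar>dyadic_ratio U t - g\<bar>) at_top"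
    using pos order_tendstoD(1)[OF ratio', of "g / 2"] order_tendstoD(2)[OF ratio', of "2 * g"]
      eventually_gt_at_top[of 1] decay g
    by (simp add: eventually_conj_iff flip: g_def)
  then obtain T where T: "\<And>t. T \<le> t \<Longrightarrow> 1 < t \<and> 0 < dyadic_incr U t \<and> g / 2 < dyadic_ratio U t \<and>
      dyadic_ratio U t < 2 * g \<and> \<bar>dyadic_ratio U (2 * t) - g\<bar> \<le> \<beta> * \<bar>dyadic_ratio U t - g\<bar>"
    unfolding eventually_at_top_linorder by blast
  have T1: "1 < T" using T[of T] by simp
  define K where "K = U (2 * T) * (1 + 2 * g) / dyadic_incr U (2 * T)"
  define B where "B = (K + 1) * exp (6 / (1 - \<mu>))"
  have R0: "0 \<le> R t" if "T \<le> t" for t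
    using T[OF that] nonneg[of t] by (simp add: R_def)
  have powr1: "t powr \<gamma> \<le> 1" if "T \<le> t" for t
    using T[OF that] \<open>\<gamma> < 0\<close> powr_mono[of \<gamma> 0 t] by simp
  have G0: "0 \<le> G t" for t
    using g by (simp add: G_def)
  have bound: "W t \<le> B" if "T \<le> t" for t
    using that
  proof (induction rule: doubling_induct)
    case pos
    then show ?case using T1 by simp
  next
    case (base s)
    have RK: "R s \<le> K"
      unfolding R_def K_def
      using T T1 base less_imp_le by (intro dyadic_quotient_bounded_base nonneg mono) blast+
    then have "R s * s powr \<gamma> \<le> K * 1"
      using R0[OF base(1)] powr1[OF base(1)] by (intro mult_mono) auto
    moreover have "\<bar>dyadic_ratio U s - g\<bar> \<le> g"
      using T[OF base(1)] g by (auto simp: abs_le_iff)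
    then have "2 / g * \<bar>dyadic_ratio U s - g\<bar> \<le> 2"
      using g by (simp add: field_simps)
    then have "G s \<le> 3"
      using powr1[OF base(1)] by (simp add: G_def)
    then have "2 * G s / (1 - \<mu>) \<le> 6 / (1 - \<mu>)"
      using \<mu> by (intro divide_right_mono) auto
    ultimately show ?case
      using RK R0[OF base(1)] unfolding W_def B_def by (intro mult_mono) auto
  next
    case (double s)
    define S where "S = R s * s powr \<gamma>"
    have s: "1 < s" "0 < dyadic_incr U s" "0 < dyadic_incr U (2 * s)" "g / 2 < dyadic_ratio U s"
      using T[of s] T[of "2 * s"] double(1) T1 by auto
    have S0: "0 \<le> S" using R0[OF double(1)] by (simp add: S_def)
    have "R (2 * s) = (R s + 1) / dyadic_ratio U s"
      unfolding R_def using s by (intro dyadic_quotient_double) auto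
    then have "R (2 * s) * (2 * s) powr \<gamma> = g / dyadic_ratio U s * (S + s powr \<gamma>)"
      using s by (simp add: S_def powr_mult g_def algebra_simps add_divide_distrib)
    also have "\<dots> \<le> (1 + G s) * (S + G s)"
    proof (rule mult_mono)
      have "g / dyadic_ratio U s = 1 + (g - dyadic_ratio U s) / dyadic_ratio U s"
        using s g by (simp add: field_simps)
      also have "\<dots> \<le> 1 + \<bar>dyadic_ratio U s - g\<bar> / (g / 2)"
        using s g by (intro add_left_mono frac_le) auto
      also have "\<dots> \<le> 1 + G s"
        by (simp add: G_def mult.commute)
      finally show "g / dyadic_ratio U s \<le> 1 + G s" .
      show "S + s powr \<gamma> \<le> S + G s"
        using g by (simp add: G_def)
    qed (use G0[of s] S0 in auto)
    finally have "R (2 * s) * (2 * s) powr \<gamma> + 1 \<le> (1 + G s) * (S + G s) + 1"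
      by simp
    also have "\<dots> \<le> (1 + G s)\<^sup>2 * (S + 1)"
      using S0 G0[of s] by (simp add: algebra_simps power2_eq_square)
    also have "\<dots> \<le> (exp (G s))\<^sup>2 * (S + 1)"
      using S0 G0[of s] by (intro mult_right_mono power_mono) auto
    also have "(exp (G s))\<^sup>2 = exp (2 * G s)"
      by (simp add: exp_double)
    finally have step: "R (2 * s) * (2 * s) powr \<gamma> + 1 \<le> exp (2 * G s) * (S + 1)" .
    have "G (2 * s) \<le> \<mu> * G s"
    proof -
      have "\<bar>dyadic_ratio U (2 * s) - g\<bar> \<le> \<beta> * \<bar>dyadic_ratio U s - g\<bar>"
        using T[OF double(1)] by simp
      also have "\<dots> \<le> \<mu> * \<bar>dyadic_ratio U s - g\<bar>"
        using \<mu> by (intro mult_right_mono) auto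
      finally have "2 / g * \<bar>dyadic_ratio U (2 * s) - g\<bar> \<le> 2 / g * (\<mu> * \<bar>dyadic_ratio U s - g\<bar>)"
        using g by (intro mult_left_mono) auto
      moreover have "(2 * s) powr \<gamma> \<le> \<mu> * s powr \<gamma>"
        using s \<mu> by (simp add: powr_mult g_def mult_right_mono)
      ultimately show ?thesis by (simp add: G_def algebra_simps)
    qed
    then have "2 * G (2 * s) / (1 - \<mu>) \<le> 2 * (\<mu> * G s) / (1 - \<mu>)"
      using \<mu> by (intro divide_right_mono mult_left_mono) auto
    then have "W (2 * s) \<le> (exp (2 * G s) * (S + 1)) * exp (2 * (\<mu> * G s) / (1 - \<mu>))"
      unfolding W_def using step S0 by (intro mult_mono) auto
    also have "\<dots> = (S + 1) * exp (2 * G s + 2 * (\<mu> * G s) / (1 - \<mu>))"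
      by (simp add: exp_add)
    also have "2 * G s + 2 * (\<mu> * G s) / (1 - \<mu>) = 2 * G s / (1 - \<mu>)"
      using \<mu> by (simp add: field_simps)
    also have "(S + 1) * exp (2 * G s / (1 - \<mu>)) = W s"
      by (simp add: W_def S_def)
    also have "\<dots> \<le> B" by fact
    finally show ?case .
  qed
  show ?thesis
  proof (rule bigoI)
    show "eventually (\<lambda>t. norm (U t / dyadic_incr U t) \<le> B * norm (t powr - \<gamma>)) at_top"
      using eventually_ge_at_top[of T]
    proof eventually_elim
      case (elim t)
      have "(R t * t powr \<gamma> + 1) * 1 \<le> W t"
        unfolding W_def using R0[OF elim] G0[of t] \<mu> by (intro mult_left_mono) auto
      then have "R t * t powr \<gamma> \<le> B" using bound[OF elim] by simp
      then have "R t \<le> B * t powr - \<gamma>"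
        using T[OF elim] by (simp add: powr_minus field_simps)
      then show ?case using R0[OF elim] by (simp add: R_def)
    qed
  qed
qed

section \<open>Growth of \<open>U\<close> relative to its scaling function\<close>

lemma erv2_over_scale_bigo:
  assumes "\<And>t. 1 < t \<Longrightarrow> 0 \<le> U t"
    and "\<And>s t. 1 < s \<Longrightarrow> s \<le> t \<Longrightarrow> U s \<le> U t"
    and erv: "erv2 U \<gamma> \<rho> a A" and "\<rho> < 0"
    and \<epsilon>: "0 \<le> \<epsilon> \<and> - \<gamma> < \<epsilon> \<or> \<gamma> < 0 \<and> \<epsilon> = - \<gamma>"
  shows "(\<lambda>t. U t / a t) \<in> O(\<lambda>t. t powr \<epsilon>)"
proof -
  note first_order = erv2_dyadic_incr_pos[OF erv] erv2_dyadic_ratio_tendsto[OF erv]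
  have "(\<lambda>t. U t / dyadic_incr U t) \<in> O(\<lambda>t. t powr \<epsilon>)"
    using \<epsilon>
  proof
    assume "0 \<le> \<epsilon> \<and> - \<gamma> < \<epsilon>"
    then show ?thesis
      using assms first_order by (intro dyadic_quotient_bigo_above_index) auto
  next
    assume *: "\<gamma> < 0 \<and> \<epsilon> = - \<gamma>"
    let ?\<eta> = "\<lambda>t. dyadic_ratio U t - 2 powr \<gamma>"
    \<comment> \<open>Any number strictly between \<open>2 powr \<rho>\<close> and \<open>1\<close> serves as a decay rate.\<close>
    define \<beta> where "\<beta> = (2 :: real) powr (\<rho> / 2)"
    have "\<beta> < 1" using \<open>\<rho> < 0\<close> by (simp add: \<beta>_def powr_less_one)
    have "\<bar>2 powr \<rho>\<bar> < \<beta>" using \<open>\<rho> < 0\<close> by (simp add: \<beta>_def)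
    from order_tendstoD(2)[OF tendsto_rabs[OF erv2_dyadic_deviation_ratio(1)[OF erv \<open>\<rho> < 0\<close>]] this]
      erv2_dyadic_deviation_ratio(2)[OF erv \<open>\<rho> < 0\<close>]
    have "eventually (\<lambda>t. \<bar>?\<eta> (2 * t)\<bar> \<le> \<beta> * \<bar>?\<eta> t\<bar>) at_top"
      by eventually_elim (simp add: field_simps)
    then show ?thesis
      using * \<open>\<beta> < 1\<close> assms first_order by (auto intro: dyadic_quotient_bigo_at_index)
  qed
  moreover have "(\<lambda>t. dyadic_incr U t / a t) \<in> O(\<lambda>_. 1)"
    using erv2_dyadic_incr_over_scale[OF erv] by (intro bigoI_tendsto) auto
  ultimately have "(\<lambda>t. U t / dyadic_incr U t * (dyadic_incr U t / a t)) \<in> O(\<lambda>t. t powr \<epsilon> * 1)"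
    by (rule landau_o.big.mult)
  then have prod: "(\<lambda>t. U t / dyadic_incr U t * (dyadic_incr U t / a t)) \<in> O(\<lambda>t. t powr \<epsilon>)"
    by (simp only: mult_1_right)
  have "eventually (\<lambda>t. U t / dyadic_incr U t * (dyadic_incr U t / a t) = U t / a t) at_top"
    using erv2_dyadic_incr_pos[OF erv] by eventually_elim simp
  from landau_o.big.in_cong[OF this] prod show ?thesis
    by (rule iffD1)
qed

theorem lemma2:
  fixes M :: "'a measure" and Y :: "'a \<Rightarrow> real"
    and \<gamma> \<rho> :: real and a A :: "real \<Rightarrow> real"
    and k :: "nat \<Rightarrow> nat" and h z :: "nat \<Rightarrow> real"
  assumes "prob_space M"
    and "Y \<in> borel_measurable M"
    and "AE \<omega> in M. Y \<omega> > 0"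
    and "\<And>n. n \<ge> 2 \<Longrightarrow> 0 < k n \<and> k n < n"
    and "filterlim k at_top sequentially"
    and "(\<lambda>n. real (k n) / real n) \<longlonglongrightarrow> 0"
    and "erv2 (tail_quantile M Y) \<gamma> \<rho> a A"
    and "\<rho> < 0"
    and "\<And>n. z n = h n * tail_quantile M Y (real n / real (k n)) / a (real n / real (k n))"
    and "(\<gamma> > 0 \<and> (\<lambda>n. sqrt (real (k n)) * h n) \<longlonglongrightarrow> 0)
       \<or> (\<gamma> = 0 \<and> (\<exists>\<delta>>0. (\<lambda>n. sqrt (real (k n)) * h n) \<in> O(\<lambda>n. (real n / real (k n)) powr - \<delta>)))
       \<or> (\<gamma> < 0 \<and> (\<lambda>n. sqrt (real (k n)) * h n) \<in> o(\<lambda>n. (real n / real (k n)) powr \<gamma>))"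
  shows "(\<lambda>n. sqrt (real (k n)) * z n) \<longlonglongrightarrow> 0"
proof -
  define U where "U = tail_quantile M Y"
  define t where "t n = real n / real (k n)" for n
  define w where "w n = sqrt (real (k n)) * h n" for n
  have U: "\<And>t. 1 < t \<Longrightarrow> 0 \<le> U t" "\<And>s t. 1 < s \<Longrightarrow> s \<le> t \<Longrightarrow> U s \<le> U t"
    using tail_quantile_nonneg_mono[OF assms(1-3)] by (auto simp: U_def)
  have t: "filterlim t at_top sequentially"
  proof -
    have "eventually (\<lambda>n. 0 < real (k n) / real n) sequentially"
      using eventually_ge_at_top[of 2] by eventually_elim (use assms(4) in force)
    with assms(6) have "filterlim (\<lambda>n. inverse (real (k n) / real n)) at_top sequentially"
      by (rule filterlim_inverse_at_top)
    then show ?thesis by (simp add: t_def[abs_def])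
  qed
  have "\<exists>\<epsilon>. (0 \<le> \<epsilon> \<and> - \<gamma> < \<epsilon> \<or> \<gamma> < 0 \<and> \<epsilon> = - \<gamma>) \<and> w \<in> o(\<lambda>n. t n powr - \<epsilon>)"
    using assms(10)
  proof (elim disjE conjE exE)
    assume "\<gamma> > 0" and lim: "(\<lambda>n. sqrt (real (k n)) * h n) \<longlonglongrightarrow> 0"
    have "w \<in> o(\<lambda>_. 1)"
      using lim by (intro smalloI_tendsto) (simp_all add: w_def)
    moreover have "eventually (\<lambda>n. 1 = t n powr - 0) sequentially"
      using filterlim_at_top_dense[THEN iffD1, OF t, rule_format, of 0] by eventually_elim simp
    then have "o(\<lambda>_. 1) = o(\<lambda>n. t n powr - 0)"
      by (rule landau_o.small.cong)
    ultimately have "w \<in> o(\<lambda>n. t n powr - 0)"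
      by simp
    then show ?thesis using \<open>\<gamma> > 0\<close> by (intro exI[of _ 0]) simp
  next
    fix \<delta> :: real
    assume "\<gamma> = 0" "\<delta> > 0"
      and O: "(\<lambda>n. sqrt (real (k n)) * h n) \<in> O(\<lambda>n. (real n / real (k n)) powr - \<delta>)"
    have "(\<lambda>s. s powr - \<delta>) \<in> o(\<lambda>s :: real. s powr - (\<delta> / 2))"
      using \<open>\<delta> > 0\<close> by real_asymp
    then have "(\<lambda>n. t n powr - \<delta>) \<in> o(\<lambda>n. t n powr - (\<delta> / 2))"
      using t by (rule landau_o.small.compose)
    with O have "w \<in> o(\<lambda>n. t n powr - (\<delta> / 2))"
      unfolding w_def t_def by (rule landau_o.big_small_trans)
    then show ?thesis
      using \<open>\<gamma> = 0\<close> \<open>\<delta> > 0\<close> by (intro exI[of _ "\<delta> / 2"]) simp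
  next
    assume "\<gamma> < 0" "(\<lambda>n. sqrt (real (k n)) * h n) \<in> o(\<lambda>n. (real n / real (k n)) powr \<gamma>)"
    then show ?thesis by (intro exI[of _ "- \<gamma>"]) (simp add: w_def[abs_def] t_def)
  qed
  then obtain \<epsilon> where \<epsilon>: "0 \<le> \<epsilon> \<and> - \<gamma> < \<epsilon> \<or> \<gamma> < 0 \<and> \<epsilon> = - \<gamma>"
    and w: "w \<in> o(\<lambda>n. t n powr - \<epsilon>)" by blast
  have "(\<lambda>t. U t / a t) \<in> O(\<lambda>t. t powr \<epsilon>)"
    using U assms(7,8) \<epsilon> by (intro erv2_over_scale_bigo) (auto simp: U_def)
  then have "(\<lambda>n. U (t n) / a (t n)) \<in> O(\<lambda>n. t n powr \<epsilon>)"
    using t by (rule landau_o.big.compose)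
  with w have "(\<lambda>n. w n * (U (t n) / a (t n))) \<in> o(\<lambda>n. t n powr - \<epsilon> * t n powr \<epsilon>)"
    by (rule landau_o.small_big_mult)
  moreover have "eventually (\<lambda>n. t n powr - \<epsilon> * t n powr \<epsilon> = 1) sequentially"
    using filterlim_at_top_dense[THEN iffD1, OF t, rule_format, of 0]
    by eventually_elim (simp flip: powr_add)
  then have "o(\<lambda>n. t n powr - \<epsilon> * t n powr \<epsilon>) = o(\<lambda>_. 1)"
    by (rule landau_o.small.cong)
  ultimately have "(\<lambda>n. w n * (U (t n) / a (t n))) \<in> o(\<lambda>_. 1)"
    by simp
  then have "(\<lambda>n. w n * (U (t n) / a (t n))) \<longlonglongrightarrow> 0"
    by (auto dest: smalloD_tendsto)
  then show ?thesis
    by (simp add: assms(9) w_def t_def U_def mult.assoc)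
qed

end
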